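(* Let $n\ge 1$ and let $P(z)=c_0+c_1z+\dots+c_nz^n$, $c_k\in\mathbb{C}$, $c_n\neq 0$, be a polynomial all of whose zeros lie in the closed disc $|z|\le 1$. Then for any point $z$ on the circle $|z|=1$ with $P(z)\neq 0$, the inequality $$\Lambda(P,z)\ \ge\ \frac{2(|c_0|-|c_n|)^2}{|c_n|^2-|c_0|^2+|\overline{c_n}\,c_1-c_0\,\overline{c_{n-1}}|}$$ holds, where in the case $|c_0|=|c_n|$ the expression on the right-hand side is understood to be zero. Equality is attained for polynomials $P$ all of whose zeros lie on the unit circle $|z|=1$, for any $z$ with $|z|=1$, $P(z)\neq 0$.
   Context: For a polynomial $P$ of degree $n$ and a point $z=e^{i\theta}$ ($\theta$ real) with $P(z)\neq 0$, define $$\Lambda(P,z)=2\,(\arg P(e^{i\theta}))'_{\theta}-n,$$ where $(\arg P(e^{i\theta}))'_\theta$ is the derivative with respect to $\theta$ of a local continuous branch of the argument of $P(e^{i\theta})$; equivalently $(\arg P(e^{i\theta}))'_\theta=\operatorname{Re}\frac{zP'(z)}{P(z)}$ at $z=e^{i\theta}$, so $\Lambda(P,z)=2\operatorname{Re}\frac{zP'(z)}{P(z)}-n$. *)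

theory Defs
  imports "HOL-Complex_Analysis.Complex_Analysis" "HOL-Computational_Algebra.Polynomial"
begin

definition local_arg_branch :: "complex poly \<Rightarrow> real \<Rightarrow> (real \<Rightarrow> real) \<Rightarrow> bool" where
  "local_arg_branch P \<theta> \<phi> \<longleftrightarrow>
     (\<exists>S. open S \<and> \<theta> \<in> S \<and> continuous_on S \<phi> \<and>
          (\<forall>t\<in>S. poly P (cis t) = of_real (norm (poly P (cis t))) * cis (\<phi> t)))"

text \<open>\<open>Lambda P z\<close> is meaningful when \<open>norm z = 1\<close> and \<open>poly P z \<noteq> 0\<close>; the lemmas below show that it
  then depends neither on the choice of \<open>\<theta>\<close> nor on that of the branch \<open>\<phi>\<close>, and that a
  differentiable branch exists.\<close>

definition Lambda :: "complex poly \<Rightarrow> complex \<Rightarrow> real" where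
  "Lambda P z =
     2 * (THE d. \<exists>\<theta> \<phi>. z = cis \<theta> \<and> local_arg_branch P \<theta> \<phi> \<and> (\<phi> has_real_derivative d) (at \<theta>))
     - real (degree P)"

lemma poly_cis_has_vector_derivative:
  "((\<lambda>t. poly P (cis t)) has_vector_derivative (\<i> * cis \<theta> * poly (pderiv P) (cis \<theta>))) (at \<theta>)"
proof -
  have c: "(cis has_vector_derivative (\<i> * cis \<theta>)) (at \<theta>)"
    unfolding cis_conv_exp
    by (rule has_vector_derivative_real_field) (auto intro!: derivative_eq_intros)
  have "(poly P \<circ> cis has_vector_derivative (\<i> * cis \<theta> * poly (pderiv P) (cis \<theta>))) (at \<theta>)"
    by (rule field_vector_diff_chain_at[OF c poly_DERIV])
  then show ?thesis by (simp add: o_def)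
qed

lemma local_arg_branch_derivative:
  assumes nz: "poly P (cis \<theta>) \<noteq> 0" and br: "local_arg_branch P \<theta> \<phi>"
    and d: "(\<phi> has_real_derivative d) (at \<theta>)"
  shows "d = Re (cis \<theta> * poly (pderiv P) (cis \<theta>) / poly P (cis \<theta>))"
proof -
  obtain S where S: "open S" "\<theta> \<in> S"
    and eq: "\<And>t. t \<in> S \<Longrightarrow> poly P (cis t) = of_real (norm (poly P (cis t))) * cis (\<phi> t)"
    using br unfolding local_arg_branch_def by blast
  define f where "f t = poly P (cis t)" for t
  define f' where "f' = \<i> * cis \<theta> * poly (pderiv P) (cis \<theta>)"
  have fd: "(f has_vector_derivative f') (at \<theta>)"
    unfolding f_def f'_def by (rule poly_cis_has_vector_derivative)
  have reD: "((\<lambda>t. Re (f t)) has_real_derivative Re f') (at \<theta>)"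
    and imD: "((\<lambda>t. Im (f t)) has_real_derivative Im f') (at \<theta>)"
    unfolding has_real_derivative_iff_has_vector_derivative
    by (rule bounded_linear.has_vector_derivative[OF bounded_linear_Re] fd
        bounded_linear.has_vector_derivative[OF bounded_linear_Im])+
  define g where "g t = Im (f t) * cos (\<phi> t) - Re (f t) * sin (\<phi> t)" for t
  have gd: "(g has_real_derivative
      (Im f' * cos (\<phi> \<theta>) - Im (f \<theta>) * sin (\<phi> \<theta>) * d
        - (Re f' * sin (\<phi> \<theta>) + Re (f \<theta>) * cos (\<phi> \<theta>) * d))) (at \<theta>)"
    unfolding g_def by (rule derivative_eq_intros reD imD d refl)+ (simp add: algebra_simps)
  have g0: "g t = 0" if "t \<in> S" for t
  proof -
    have "Re (f t) = norm (f t) * cos (\<phi> t)" "Im (f t) = norm (f t) * sin (\<phi> t)"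
      using arg_cong[OF eq[OF that], of Re] arg_cong[OF eq[OF that], of Im] by (simp_all add: f_def)
    then show ?thesis unfolding g_def by (metis (no_types) mult.commute mult.left_commute right_minus_eq)
  qed
  have "(g has_real_derivative 0) (at \<theta>)"
    by (rule has_field_derivative_transform_within_open[of "\<lambda>_. 0" 0 \<theta> S]) (use S g0 in auto)
  then have z: "Im f' * cos (\<phi> \<theta>) - Im (f \<theta>) * sin (\<phi> \<theta>) * d
        - (Re f' * sin (\<phi> \<theta>) + Re (f \<theta>) * cos (\<phi> \<theta>) * d) = 0"
    using gd DERIV_unique by blast
  define r where "r = norm (f \<theta>)"
  have r: "r > 0" using nz by (simp add: r_def f_def)
  have f\<theta>: "f \<theta> = of_real r * cis (\<phi> \<theta>)" using eq[OF S(2)] by (simp add: f_def r_def)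
  have "Im f' * cos (\<phi> \<theta>) - Re f' * sin (\<phi> \<theta>) = r * d * ((sin (\<phi> \<theta>))\<^sup>2 + (cos (\<phi> \<theta>))\<^sup>2)"
    using z unfolding power2_eq_square by (simp add: f\<theta> algebra_simps del: sin_cos_squared_add3)
  then have dd: "d = (Im f' * cos (\<phi> \<theta>) - Re f' * sin (\<phi> \<theta>)) / r"
    using r by simp
  have "f' / f \<theta> = f' * cis (- \<phi> \<theta>) / of_real r"
    by (simp add: f\<theta> cis_inverse[symmetric] divide_simps)
  then have "Im (f' / f \<theta>) = d" by (simp add: dd Im_divide_of_real)
  moreover have "f' / f \<theta> = \<i> * (cis \<theta> * poly (pderiv P) (cis \<theta>) / poly P (cis \<theta>))"
    by (simp add: f'_def f_def mult.assoc)
  ultimately show ?thesis by (metis Im_i_times)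
qed

lemma local_arg_branch_exists:
  assumes nz: "poly P (cis \<theta>) \<noteq> 0"
  shows "\<exists>\<phi> d. local_arg_branch P \<theta> \<phi> \<and> (\<phi> has_real_derivative d) (at \<theta>)"
proof -
  define f where "f t = poly P (cis t)" for t
  define h where "h t = f t / f \<theta>" for t
  define S where "S = h -` (- \<real>\<^sub>\<le>\<^sub>0)"
  define \<phi> where "\<phi> t = Im (Ln (h t)) + Arg (f \<theta>)" for t
  have nz': "f \<theta> \<noteq> 0" using nz by (simp add: f_def)
  have ch: "continuous_on UNIV h"
    unfolding h_def f_def by (intro continuous_intros) (use nz' f_def in auto)
  have oS: "open S" unfolding S_def
    by (rule open_vimage) (use ch in \<open>auto intro: closed_nonpos_Reals_complex simp: open_Compl\<close>)
  have \<theta>S: "\<theta> \<in> S" using nz' by (simp add: S_def h_def)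
  have c\<phi>: "continuous_on S \<phi>" unfolding \<phi>_def
    by (intro continuous_intros continuous_on_subset[OF ch]) (auto simp: S_def)
  have "f t = of_real (norm (f t)) * cis (\<phi> t)" if "t \<in> S" for t
  proof -
    have h0: "h t \<noteq> 0" using that by (auto simp: S_def)
    have "f t = h t * f \<theta>" using nz' by (simp add: h_def)
    also have "\<dots> = (of_real (norm (h t)) * cis (Im (Ln (h t)))) * (of_real (norm (f \<theta>)) * cis (Arg (f \<theta>)))"
      using rcis_cmod_Arg[of "h t"] rcis_cmod_Arg[of "f \<theta>"] h0 by (simp add: rcis_def Arg_eq_Im_Ln)
    also have "\<dots> = of_real (norm (f t)) * cis (\<phi> t)"
      using nz' by (simp add: \<phi>_def cis_mult[symmetric] h_def norm_divide)
    finally show ?thesis .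
  qed
  then have "local_arg_branch P \<theta> \<phi>"
    unfolding local_arg_branch_def using oS \<theta>S c\<phi> by (auto simp: f_def)
  moreover have "\<exists>d. (\<phi> has_real_derivative d) (at \<theta>)"
  proof -
    define f' where "f' = \<i> * cis \<theta> * poly (pderiv P) (cis \<theta>)"
    have fd: "(f has_vector_derivative f') (at \<theta>)"
      unfolding f_def f'_def by (rule poly_cis_has_vector_derivative)
    have hd: "(h has_vector_derivative (f' / f \<theta>)) (at \<theta>)"
      unfolding h_def by (rule has_vector_derivative_divide[OF fd])
    have "(Ln \<circ> h has_vector_derivative (f' / f \<theta> * inverse (h \<theta>))) (at \<theta>)"
      by (rule field_vector_diff_chain_at[OF hd has_field_derivative_Ln]) (use \<theta>S in \<open>auto simp: S_def\<close>)
    then have "((\<lambda>t. Im ((Ln \<circ> h) t)) has_real_derivative Im (f' / f \<theta> * inverse (h \<theta>))) (at \<theta>)"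
      unfolding has_real_derivative_iff_has_vector_derivative
      by (rule bounded_linear.has_vector_derivative[OF bounded_linear_Im])
    then have "(\<phi> has_real_derivative Im (f' / f \<theta> * inverse (h \<theta>)) + 0) (at \<theta>)"
      unfolding \<phi>_def o_def by (rule DERIV_add) (rule DERIV_const)
    then show ?thesis by blast
  qed
  ultimately show ?thesis by blast
qed

lemma Lambda_eq:
  assumes "norm z = 1" "poly P z \<noteq> 0"
  shows "Lambda P z = 2 * Re (z * poly (pderiv P) z / poly P z) - real (degree P)"
proof -
  have "(THE d. \<exists>\<theta> \<phi>. z = cis \<theta> \<and> local_arg_branch P \<theta> \<phi> \<and> (\<phi> has_real_derivative d) (at \<theta>))
      = Re (z * poly (pderiv P) z / poly P z)"
  proof (rule the_equality)
    have "z = cis (Arg z)" using assms(1) rcis_cmod_Arg[of z] by (simp add: rcis_def)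
    then obtain \<theta> where z: "z = cis \<theta>" ..
    obtain \<phi> d where b: "local_arg_branch P \<theta> \<phi>" "(\<phi> has_real_derivative d) (at \<theta>)"
      using local_arg_branch_exists assms(2) z by blast
    have "d = Re (z * poly (pderiv P) z / poly P z)"
      using local_arg_branch_derivative[OF _ b] assms(2) z by blast
    then show "\<exists>\<theta> \<phi>. z = cis \<theta> \<and> local_arg_branch P \<theta> \<phi> \<and>
        (\<phi> has_real_derivative Re (z * poly (pderiv P) z / poly P z)) (at \<theta>)"
      using z b by blast
  next
    fix d assume "\<exists>\<theta> \<phi>. z = cis \<theta> \<and> local_arg_branch P \<theta> \<phi> \<and> (\<phi> has_real_derivative d) (at \<theta>)"
    then show "d = Re (z * poly (pderiv P) z / poly P z)"
      using local_arg_branch_derivative assms(2) by blast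
  qed
  then show ?thesis by (simp add: Lambda_def)
qed

definition coeff_bound :: "complex poly \<Rightarrow> real" where
  "coeff_bound P = (let n = degree P; c = coeff P in
     if norm (c 0) = norm (c n) then 0
     else 2 * (norm (c 0) - norm (c n))\<^sup>2 /
       ((norm (c n))\<^sup>2 - (norm (c 0))\<^sup>2 + norm (cnj (c n) * c 1 - c 0 * cnj (c (n - 1)))))"

end

theory Submission
  imports Defs "HOL-Computational_Algebra.Fundamental_Theorem_Algebra"
begin

text \<open>
  Let \<open>P\<^sup>*(w) = w^n * cnj (P (1 / cnj w))\<close> be the conjugate reciprocal of \<open>P\<close>, where
  \<open>n\<close> is the degree. The quotient \<open>f = P / P\<^sup>*\<close> is a finite Blaschke product, and on the unit circle \<open>\<Lambda> = z f'(z) / f(z)\<close>, so the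
  claim is a boundary Schwarz lemma for \<open>f\<close> in which \<open>f(0)\<close> and \<open>f'(0)\<close> enter.

  It follows from positivity of the kernel of \<open>f\<close>, which becomes explicit after multiplication by
  \<open>P\<^sup>*\<close>: there are polynomials \<open>E\<^sub>k\<close>, \<open>k < n\<close>, with
  \<open>P\<^sup>*(w) cnj (P\<^sup>*(v)) - P(w) cnj (P(v)) = (1 - w cnj v) (\<Sum>k<n. E\<^sub>k(w) cnj (E\<^sub>k(v)))\<close>.
  They are built one zero at a time (\<open>sum_of_squares_kernel_exists\<close>); on the unit circle
  \<open>\<Sum>k<n. |E\<^sub>k(z)|\<^sup>2\<close> equals \<open>\<Lambda>(P,z) |P(z)|\<^sup>2\<close>, and a zero of modulus \<open>1\<close> adds only
  the zero polynomial to the family, which settles the case of equality.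

  Comparing coefficients in the kernel identity gives all inner products of the three vectors
  \<open>u = (E\<^sub>k(z))\<close>, \<open>p = (E\<^sub>k(0))\<close>, \<open>q = (E\<^sub>k'(0))\<close> of \<open>\<complex>\<^sup>n\<close> (\<open>kernel_coefficients\<close>), apart from \<open>\<parallel>u\<parallel>\<^sup>2\<close>.
  The Cauchy--Schwarz inequality for \<open>u\<close> and a suitable vector in the span of \<open>p\<close> and \<open>q\<close>
  (\<open>gram_lower_bound\<close>) bounds \<open>\<parallel>u\<parallel>\<^sup>2\<close> from below. With \<open>D = |c\<^sub>n|\<^sup>2 - |c\<^sub>0|\<^sup>2 = \<parallel>p\<parallel>\<^sup>2\<close> and
  \<open>e = cnj c\<^sub>n * c\<^sub>1 - c\<^sub>0 * cnj c\<^sub>n\<^sub>-\<^sub>1\<close>, which are the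
  numerators of \<open>1 - |f(0)|\<^sup>2\<close> and \<open>f'(0)\<close>, the bound is \<open>2 |<u,p>|\<^sup>2 / (D + |e|)\<close>, and
  \<open>|<u,p>| = |P\<^sup>*(z) c\<^sub>n - P(z) cnj c\<^sub>0| \<ge> (|c\<^sub>n| - |c\<^sub>0|) |P(z)|\<close>.
\<close>

section \<open>A sum-of-squares kernel for a polynomial with zeros in the disc\<close>

definition conj_reciprocal :: "complex poly \<Rightarrow> complex poly" where
  "conj_reciprocal P = map_poly cnj (reflect_poly P)"

lemma map_poly_cnj_mult: "map_poly cnj (p * q) = map_poly cnj p * map_poly cnj q"
  by (intro poly_ext) (metis complex_cnj_cnj complex_cnj_mult poly_cnj poly_mult)

lemma conj_reciprocal_mult_linear:
  "conj_reciprocal ([:- a, 1:] * Q) = [:1, - cnj a:] * conj_reciprocal Q"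
proof -
  have "reflect_poly [:- a, 1:] = [:1, - a:]"
    by (cases "a = 0") (simp_all add: reflect_poly_def)
  then show ?thesis
    by (simp add: conj_reciprocal_def reflect_poly_mult map_poly_cnj_mult map_poly_pCons
        del: mult_pCons_left)
qed

text \<open>
  The kernel identity for the single factor \<open>w - a\<close>. The right-hand side carries the weight
  \<open>1 - |a|\<^sup>2\<close>, which has a real square root when \<open>a\<close> lies in the closed disc.
\<close>

lemma blaschke_kernel_step:
  fixes a w v :: complex
  shows "(1 - cnj a * w) * cnj (1 - cnj a * v) - (w - a) * cnj (v - a)
    = of_real (1 - (norm a)\<^sup>2) * (1 - w * cnj v)"
  by (simp add: complex_norm_square algebra_simps del: of_real_power)

lemma norm_one_minus_cnj_mult:
  fixes a z :: complex
  assumes "norm z = 1"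
  shows "norm (1 - cnj a * z) = norm (z - a)"
proof -
  have "1 - cnj a * z = z * cnj (z - a)"
    using complex_norm_square[of z] assms by (simp add: algebra_simps)
  then show ?thesis using assms by (simp add: norm_mult del: complex_cnj_diff)
qed

text \<open>
  Splitting off a zero, \<open>P = (X - a) Q\<close>, gives
  \<open>P\<^sup>*P\<^sup>* - PP = (1 - cnj a w)(1 - a cnj v)(Q\<^sup>*Q\<^sup>* - QQ) + QQ (1 - |a|\<^sup>2)(1 - w cnj v)\<close>, where each product
  stands for a value at \<open>w\<close> times a conjugate value at \<open>v\<close>. Hence a family for \<open>P\<close> consists of the
  family for \<open>Q\<close> multiplied by \<open>1 - cnj a X\<close>, together with \<open>sqrt (1 - |a|\<^sup>2) Q\<close>. Working with
  polynomials instead of the quotient \<open>P / P\<^sup>*\<close> treats zeros on the circle, where the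
  quotient cancels, in the same way as all others. The second property expresses \<open>\<Lambda>(P,z) |P(z)|\<^sup>2\<close>
  by the kernel on the diagonal at the boundary, where the factor \<open>1 - w cnj v\<close> vanishes; the
  recursion gives it without passing to a limit.
\<close>

lemma sum_of_squares_kernel_exists:
  fixes P :: "complex poly"
  assumes "\<And>w. poly P w = 0 \<Longrightarrow> norm w \<le> 1" and "P \<noteq> 0"
  shows "\<exists>E. (\<forall>w v. poly (conj_reciprocal P) w * cnj (poly (conj_reciprocal P) v)
               - poly P w * cnj (poly P v)
             = (1 - w * cnj v) * (\<Sum>k<degree P. poly (E k) w * cnj (poly (E k) v)))
    \<and> (\<forall>z. norm z = 1 \<longrightarrow> (\<Sum>k<degree P. (norm (poly (E k) z))\<^sup>2)
             = 2 * Re (z * poly (pderiv P) z * cnj (poly P z)) - degree P * (norm (poly P z))\<^sup>2)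
    \<and> ((\<forall>w. poly P w = 0 \<longrightarrow> norm w = 1) \<longrightarrow> (\<forall>k<degree P. E k = 0))"
  using assms
proof (induction "degree P" arbitrary: P)
  case 0
  then obtain c where P: "P = [:c:]" by (metis degree_eq_zeroE)
  show ?case
    by (rule exI[of _ "\<lambda>_. 0"])
      (simp add: P conj_reciprocal_def map_poly_pCons)
next
  case (Suc m)
  have "\<not> constant (poly P)" using Suc.hyps(2) by (simp add: constant_degree)
  from fundamental_theorem_of_algebra[OF this] obtain a where a: "poly P a = 0" ..
  then obtain Q where PQ: "P = [:- a, 1:] * Q"
    by (metis dvdE poly_eq_0_iff_dvd)
  have Q0: "Q \<noteq> 0" using PQ Suc.prems(2) by auto
  have dP: "degree P = Suc (degree Q)"
    unfolding PQ using Q0 by (subst degree_mult_eq) auto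
  have dQ: "m = degree Q" using dP Suc.hyps(2) by simp
  have rQ: "poly P w = 0" if "poly Q w = 0" for w using that PQ by simp
  have na: "norm a \<le> 1" using a Suc.prems(1) by blast
  define s where "s = sqrt (1 - (norm a)\<^sup>2)"
  have s2: "s * s = 1 - (norm a)\<^sup>2"
    unfolding s_def using na by (simp add: power_le_one)
  obtain E where
      ker: "\<And>w v. poly (conj_reciprocal Q) w * cnj (poly (conj_reciprocal Q) v)
               - poly Q w * cnj (poly Q v)
             = (1 - w * cnj v) * (\<Sum>k<degree Q. poly (E k) w * cnj (poly (E k) v))"
    and circ: "\<And>z. norm z = 1 \<Longrightarrow> (\<Sum>k<degree Q. (norm (poly (E k) z))\<^sup>2)
             = 2 * Re (z * poly (pderiv Q) z * cnj (poly Q z)) - degree Q * (norm (poly Q z))\<^sup>2"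
    and unit: "(\<forall>w. poly Q w = 0 \<longrightarrow> norm w = 1) \<Longrightarrow> (\<forall>k<degree Q. E k = 0)"
    using Suc.hyps(1)[OF dQ] Suc.prems(1) rQ Q0 by blast
  define F where "F k = (if k < degree Q then [:1, - cnj a:] * E k else smult (of_real s) Q)" for k
  have Fl: "poly (F k) w = (1 - cnj a * w) * poly (E k) w" if "k < degree Q" for k w
    using that by (simp add: F_def algebra_simps)
  have Fd: "poly (F (degree Q)) w = of_real s * poly Q w" for w
    by (simp add: F_def)
  have Pw: "poly P w = (w - a) * poly Q w" for w by (simp add: PQ algebra_simps)
  have Rw: "poly (conj_reciprocal P) w = (1 - cnj a * w) * poly (conj_reciprocal Q) w" for w
    unfolding PQ conj_reciprocal_mult_linear by (simp add: algebra_simps)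
  show ?case
  proof (intro exI[of _ F] conjI allI impI)
    fix w v
    let ?L = "\<lambda>w. 1 - cnj a * w"
    have "poly (conj_reciprocal P) w * cnj (poly (conj_reciprocal P) v) - poly P w * cnj (poly P v)
      = ?L w * cnj (?L v) * (poly (conj_reciprocal Q) w * cnj (poly (conj_reciprocal Q) v)
          - poly Q w * cnj (poly Q v))
        + poly Q w * cnj (poly Q v) * (?L w * cnj (?L v) - (w - a) * cnj (v - a))"
      unfolding Pw Rw by (simp add: algebra_simps)
    also have "\<dots> = (1 - w * cnj v) *
        (?L w * cnj (?L v) * (\<Sum>k<degree Q. poly (E k) w * cnj (poly (E k) v))
          + of_real (s * s) * (poly Q w * cnj (poly Q v)))"
      unfolding ker blaschke_kernel_step s2 by (simp only: algebra_simps)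
    also have "?L w * cnj (?L v) * (\<Sum>k<degree Q. poly (E k) w * cnj (poly (E k) v))
        = (\<Sum>k<degree Q. poly (F k) w * cnj (poly (F k) v))"
      unfolding sum_distrib_left by (intro sum.cong) (simp_all add: Fl)
    finally show "poly (conj_reciprocal P) w * cnj (poly (conj_reciprocal P) v)
        - poly P w * cnj (poly P v)
      = (1 - w * cnj v) * (\<Sum>k<degree P. poly (F k) w * cnj (poly (F k) v))"
      unfolding dP by (simp add: Fd)
  next
    fix z :: complex
    assume z: "norm z = 1"
    let ?q = "poly Q z" and ?q' = "poly (pderiv Q) z"
    have P': "poly (pderiv P) z = ?q + (z - a) * ?q'"
      unfolding PQ pderiv_mult by (simp add: pderiv_pCons algebra_simps)
    have old_terms: "(\<Sum>k<degree Q. (norm (poly (F k) z))\<^sup>2)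
        = (norm (z - a))\<^sup>2 * (\<Sum>k<degree Q. (norm (poly (E k) z))\<^sup>2)"
      unfolding sum_distrib_left
      by (intro sum.cong)
        (simp_all add: Fl norm_mult power_mult_distrib norm_one_minus_cnj_mult[OF z])
    have new_term: "(norm (poly (F (degree Q)) z))\<^sup>2 = (1 - (norm a)\<^sup>2) * (norm ?q)\<^sup>2"
      using s2 by (simp add: Fd norm_mult power_mult_distrib power2_eq_square)
    have linear_factor: "2 * Re (z * cnj (z - a)) - (norm (z - a))\<^sup>2 = 1 - (norm a)\<^sup>2"
    proof -
      have "(norm z)\<^sup>2 = 1" using z by simp
      then show ?thesis unfolding cmod_power2 by (simp add: algebra_simps power2_eq_square)
    qed
    have derivative: "Re (z * poly (pderiv P) z * cnj (poly P z))
        = Re (z * cnj (z - a)) * (norm ?q)\<^sup>2 + (norm (z - a))\<^sup>2 * Re (z * ?q' * cnj ?q)"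
    proof -
      have "z * poly (pderiv P) z * cnj (poly P z)
        = z * cnj (z - a) * (?q * cnj ?q) + ((z - a) * cnj (z - a)) * (z * ?q' * cnj ?q)"
        unfolding P' Pw by (simp add: algebra_simps)
      also have "\<dots> = of_real ((norm ?q)\<^sup>2) * (z * cnj (z - a))
          + of_real ((norm (z - a))\<^sup>2) * (z * ?q' * cnj ?q)"
        unfolding complex_norm_square by (simp only: mult.commute)
      finally have "z * poly (pderiv P) z * cnj (poly P z)
        = of_real ((norm ?q)\<^sup>2) * (z * cnj (z - a))
          + of_real ((norm (z - a))\<^sup>2) * (z * ?q' * cnj ?q)" .
      moreover have Re_of_real_times: "Re (of_real r * x) = r * Re x" for r x by simp
      ultimately show ?thesis
        by (simp only: plus_complex.sel Re_of_real_times mult.commute[of "Re _" "(norm ?q)\<^sup>2"])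
    qed
    have value_P: "(norm (poly P z))\<^sup>2 = (norm (z - a))\<^sup>2 * (norm ?q)\<^sup>2"
      by (simp add: Pw norm_mult power_mult_distrib)
    have combine: "M * (2 * R - m * N) + K * N = 2 * (T * N + M * R) - (m + 1) * (M * N)"
      if "2 * T - M = K" for M R m N K T :: real
      unfolding that[symmetric] by (simp add: algebra_simps)
    show "(\<Sum>k<degree P. (norm (poly (F k) z))\<^sup>2)
        = 2 * Re (z * poly (pderiv P) z * cnj (poly P z)) - degree P * (norm (poly P z))\<^sup>2"
      unfolding dP sum.lessThan_Suc old_terms new_term circ[OF z] derivative value_P
        combine[OF linear_factor]
      by (simp only: of_nat_Suc add.commute)
  next
    fix k
    assume u: "\<forall>w. poly P w = 0 \<longrightarrow> norm w = 1" and "k < degree P"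
    have "s = 0" using u a by (simp add: s_def)
    moreover have "\<forall>k<degree Q. E k = 0" using u rQ unit by blast
    ultimately show "F k = 0" by (simp add: F_def)
  qed
qed

section \<open>Gram matrix of the leading coefficients\<close>

lemma coeff_of_eval_sum:
  fixes E :: "nat \<Rightarrow> complex poly"
  assumes "\<And>w. (\<Sum>k<n. poly (E k) w * a k) = poly R w"
  shows "(\<Sum>k<n. coeff (E k) j * a k) = coeff R j"
proof -
  have "(\<Sum>k<n. smult (a k) (E k)) = R"
    by (intro poly_ext) (simp add: poly_sum assms[symmetric] mult.commute)
  then show ?thesis by (auto simp: coeff_sum mult.commute)
qed

text \<open>
  For fixed \<open>w\<close> the kernel identity is an identity between polynomials in \<open>cnj v\<close>; its
  coefficients of order \<open>0\<close> and \<open>1\<close> are the inner products of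
  \<open>(E\<^sub>k(w))\<close> with \<open>p = (E\<^sub>k(0))\<close> and \<open>q = (E\<^sub>k'(0))\<close>. The shift in the
  second one comes from the factor \<open>1 - w cnj v\<close>.
\<close>

lemma kernel_coefficients:
  fixes A B :: "complex poly" and E :: "nat \<Rightarrow> complex poly"
  assumes "\<And>w v. poly A w * cnj (poly A v) - poly B w * cnj (poly B v)
     = (1 - w * cnj v) * (\<Sum>k<n. poly (E k) w * cnj (poly (E k) v))"
  shows "(\<Sum>k<n. poly (E k) w * cnj (coeff (E k) 0))
      = poly A w * cnj (coeff A 0) - poly B w * cnj (coeff B 0)" (is ?zero)
    and "(\<Sum>k<n. poly (E k) w * cnj (coeff (E k) 1))
      = w * (\<Sum>k<n. poly (E k) w * cnj (coeff (E k) 0))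
        + poly A w * cnj (coeff A 1) - poly B w * cnj (coeff B 1)" (is ?one)
proof -
  let ?S = "\<Sum>k<n. smult (poly (E k) w) (map_poly cnj (E k))"
  have eq: "smult (poly A w) (map_poly cnj A) - smult (poly B w) (map_poly cnj B)
      = [:1, - w:] * ?S"
  proof (rule poly_ext)
    fix x
    show "poly (smult (poly A w) (map_poly cnj A) - smult (poly B w) (map_poly cnj B)) x
      = poly ([:1, - w:] * ?S) x"
      using assms[of w "cnj x"] by (simp add: poly_sum algebra_simps)
  qed
  show ?zero
    using arg_cong[OF eq, of "\<lambda>p. coeff p 0"] by (simp add: coeff_map_poly coeff_sum)
  show ?one
    using arg_cong[OF eq, of "\<lambda>p. coeff p 1"]
    by (simp add: coeff_map_poly coeff_sum coeff_pCons algebra_simps)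
qed

section \<open>The extremal Cauchy--Schwarz inequality\<close>

lemma complex_Cauchy_Schwarz_sum:
  fixes u y :: "nat \<Rightarrow> complex"
  shows "(norm (\<Sum>k<n. u k * cnj (y k)))\<^sup>2 \<le> (\<Sum>k<n. (norm (u k))\<^sup>2) * (\<Sum>k<n. (norm (y k))\<^sup>2)"
proof -
  have "norm (\<Sum>k<n. u k * cnj (y k)) \<le> (\<Sum>k<n. norm (u k) * norm (y k))"
    by (rule order_trans[OF norm_sum]) (simp add: norm_mult)
  then have "(norm (\<Sum>k<n. u k * cnj (y k)))\<^sup>2 \<le> (\<Sum>k<n. norm (u k) * norm (y k))\<^sup>2"
    by (intro power_mono) auto
  also have "\<dots> \<le> (\<Sum>k<n. (norm (u k))\<^sup>2) * (\<Sum>k<n. (norm (y k))\<^sup>2)"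
    by (rule Cauchy_Schwarz_ineq_sum)
  finally show ?thesis .
qed

text \<open>
  The prescribed inner products are those which the kernel identity yields for
  \<open>A = P\<^sup>*(z)\<close>, \<open>B = P(z)\<close>, where \<open>a, a1\<close> and \<open>b, b1\<close> are the coefficients of order \<open>0, 1\<close> of \<open>P\<^sup>*\<close> and
  \<open>P\<close>. Write \<open>s = |<u,p>|\<close>, \<open>e = a b1 - b a1\<close> and \<open>r = b A - a B\<close>. The vector
  \<open>x = D q - <q,p> p\<close> is orthogonal to \<open>p\<close>, and
  \<open>\<parallel>x\<parallel>\<^sup>2 = D (D\<^sup>2 - |e|\<^sup>2)\<close>, while \<open><u,x> = D z <u,p> + cnj e * r\<close> with \<open>|r| = s\<close>. The projection of \<open>u\<close>
  to the span of \<open>p\<close> and \<open>x\<close> therefore has squared length at least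
  \<open>s\<^sup>2 / D + s\<^sup>2 (D - |e|)\<^sup>2 / (D (D\<^sup>2 - |e|\<^sup>2)) = 2 s\<^sup>2 / (D + |e|)\<close>. In the worst case, when \<open>cnj e * r\<close>
  points opposite to \<open>z <u,p>\<close>, this projection is parallel to \<open>y = (D + |e|) p + z x\<close>. Applying
  Cauchy--Schwarz to \<open>u\<close> and \<open>y\<close> alone avoids dividing by \<open>D - |e|\<close>, which may vanish.
\<close>

lemma gram_lower_bound:
  fixes u p q :: "nat \<Rightarrow> complex" and z a b a1 b1 :: complex and A B :: complex
  defines "D \<equiv> (norm a)\<^sup>2 - (norm b)\<^sup>2"
  assumes z: "norm z = 1" and AB: "norm A = norm B" and D: "D > 0"
    and up: "(\<Sum>k<n. u k * cnj (p k)) = A * cnj a - B * cnj b"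
    and uq: "(\<Sum>k<n. u k * cnj (q k))
      = z * (\<Sum>k<n. u k * cnj (p k)) + A * cnj a1 - B * cnj b1"
    and pp: "(\<Sum>k<n. p k * cnj (p k)) = a * cnj a - b * cnj b"
    and qp: "(\<Sum>k<n. q k * cnj (p k)) = a1 * cnj a - b1 * cnj b"
    and qq: "(\<Sum>k<n. q k * cnj (q k))
      = (\<Sum>k<n. p k * cnj (p k)) + a1 * cnj a1 - b1 * cnj b1"
  shows "2 * (norm (A * cnj a - B * cnj b))\<^sup>2
    \<le> (\<Sum>k<n. (norm (u k))\<^sup>2) * (D + norm (a * b1 - b * a1))"
proof -
  define g where "g = a1 * cnj a - b1 * cnj b"
  define e where "e = a * b1 - b * a1"
  define s where "s = norm (A * cnj a - B * cnj b)"
  define t where "t = D + norm e"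
  define x where "x k = of_real D * q k - g * p k" for k
  define y where "y k = of_real t * p k + z * x k" for k
  have cD: "complex_of_real D = a * cnj a - b * cnj b"
    by (simp add: D_def complex_norm_square del: of_real_power)
  have pq: "(\<Sum>k<n. p k * cnj (q k)) = cnj g"
    unfolding g_def qp[symmetric] by (simp add: mult.commute)
  have ce: "complex_of_real ((norm e)\<^sup>2) = e * cnj e"
    by (rule complex_norm_square)
  have sum_x: "(\<Sum>k<n. h k * cnj (x k))
      = of_real D * (\<Sum>k<n. h k * cnj (q k)) - cnj g * (\<Sum>k<n. h k * cnj (p k))"
    for h :: "nat \<Rightarrow> complex"
    by (simp add: x_def algebra_simps sum_subtractf sum_distrib_left)
  have xp: "(\<Sum>k<n. x k * cnj (p k)) = 0"
  proof -
    have "(\<Sum>k<n. x k * cnj (p k))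
      = of_real D * (\<Sum>k<n. q k * cnj (p k)) - g * (\<Sum>k<n. p k * cnj (p k))"
      by (simp add: x_def algebra_simps sum_subtractf sum_distrib_left)
    then show ?thesis unfolding qp pp cD g_def by (simp add: algebra_simps)
  qed
  have xx: "(\<Sum>k<n. x k * cnj (x k)) = of_real (D * (D\<^sup>2 - (norm e)\<^sup>2))"
  proof -
    have "(\<Sum>k<n. x k * cnj (x k))
      = of_real D * (\<Sum>k<n. x k * cnj (q k)) - cnj g * (\<Sum>k<n. x k * cnj (p k))"
      by (rule sum_x)
    also have "(\<Sum>k<n. x k * cnj (q k))
      = of_real D * (\<Sum>k<n. q k * cnj (q k)) - g * (\<Sum>k<n. p k * cnj (q k))"
      by (simp add: x_def algebra_simps sum_subtractf sum_distrib_left)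
    finally have *: "(\<Sum>k<n. x k * cnj (x k)) = of_real D *
      (of_real D * (of_real D + a1 * cnj a1 - b1 * cnj b1) - g * cnj g)"
      unfolding xp pq qq pp cD by simp
    have "of_real D * (a1 * cnj a1 - b1 * cnj b1) - g * cnj g = - (e * cnj e)"
      unfolding cD g_def e_def by (simp add: algebra_simps)
    then have "of_real D * (of_real D + a1 * cnj a1 - b1 * cnj b1) - g * cnj g
      = complex_of_real (D\<^sup>2 - (norm e)\<^sup>2)"
      unfolding of_real_diff ce by (simp add: algebra_simps power2_eq_square)
    then show ?thesis unfolding * by simp
  qed
  have yy: "(\<Sum>k<n. (norm (y k))\<^sup>2) = 2 * D\<^sup>2 * t"
  proof -
    have px: "(\<Sum>k<n. p k * cnj (x k)) = 0"
      using arg_cong[OF xp, of cnj] by (simp add: mult.commute)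
    have zz: "z * cnj z = 1" using complex_norm_square[of z] z by simp
    have "complex_of_real (\<Sum>k<n. (norm (y k))\<^sup>2) = (\<Sum>k<n. y k * cnj (y k))"
      by (simp only: of_real_sum complex_norm_square)
    also have "\<dots> = of_real (t\<^sup>2) * (\<Sum>k<n. p k * cnj (p k))
        + of_real t * cnj z * (\<Sum>k<n. p k * cnj (x k))
        + of_real t * z * (\<Sum>k<n. x k * cnj (p k)) + z * cnj z * (\<Sum>k<n. x k * cnj (x k))"
      by (simp add: y_def algebra_simps sum.distrib sum_distrib_left power2_eq_square)
    also have "\<dots> = of_real (t\<^sup>2 * D + D * (D\<^sup>2 - (norm e)\<^sup>2))"
      unfolding px xp xx zz pp cD[symmetric] by simp
    also have "t\<^sup>2 * D + D * (D\<^sup>2 - (norm e)\<^sup>2) = 2 * D\<^sup>2 * t"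
      unfolding t_def by (simp add: algebra_simps power2_eq_square)
    finally show ?thesis by (simp only: of_real_eq_iff)
  qed
  have uy: "norm (\<Sum>k<n. u k * cnj (y k)) \<ge> 2 * D * s"
  proof -
    let ?v = "A * cnj a - B * cnj b"
    let ?r = "b * A - a * B"
    have zz: "cnj z * z = 1" using complex_norm_square[of z] z by (simp add: mult.commute)
    have "(\<Sum>k<n. u k * cnj (x k))
      = of_real D * (\<Sum>k<n. u k * cnj (q k)) - cnj g * (\<Sum>k<n. u k * cnj (p k))"
      by (rule sum_x)
    also have "\<dots> = of_real D * z * ?v + cnj e * ?r"
      unfolding uq up cD g_def e_def by (simp add: algebra_simps)
    finally have ux: "(\<Sum>k<n. u k * cnj (x k)) = of_real D * z * ?v + cnj e * ?r" .
    have "(\<Sum>k<n. u k * cnj (y k))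
      = of_real t * (\<Sum>k<n. u k * cnj (p k)) + cnj z * (\<Sum>k<n. u k * cnj (x k))"
      by (simp add: y_def algebra_simps sum.distrib sum_distrib_left)
    also have "\<dots> = of_real t * ?v + (cnj z * z) * of_real D * ?v + cnj z * cnj e * ?r"
      unfolding up ux by (simp add: algebra_simps)
    finally have *: "(\<Sum>k<n. u k * cnj (y k)) = of_real (t + D) * ?v + cnj z * cnj e * ?r"
      unfolding zz by (simp add: algebra_simps)
    have "norm ?r = s"
    proof -
      have "A * cnj A = B * cnj B"
        by (metis AB complex_norm_square)
      moreover have "?r * cnj ?r - ?v * cnj ?v
          = (A * cnj A - B * cnj B) * (b * cnj b - a * cnj a)"
        by (simp add: algebra_simps)
      ultimately have "complex_of_real ((norm ?r)\<^sup>2) = of_real ((norm ?v)\<^sup>2)"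
        unfolding complex_norm_square by simp
      then show ?thesis by (simp only: of_real_eq_iff s_def power2_eq_iff_nonneg norm_ge_zero)
    qed
    then have "norm (cnj z * cnj e * ?r) = norm e * s"
      using z by (simp add: norm_mult)
    moreover have "norm (of_real (t + D) * ?v) = (t + D) * s"
      using D by (simp add: norm_mult s_def t_def del: of_real_add)
    ultimately show ?thesis
      unfolding * using norm_diff_ineq[of "of_real (t + D) * ?v" "cnj z * cnj e * ?r"]
      by (simp add: t_def algebra_simps)
  qed
  have s0: "0 \<le> s" by (simp add: s_def)
  have "(2 * D * s)\<^sup>2 \<le> (norm (\<Sum>k<n. u k * cnj (y k)))\<^sup>2"
    using uy D s0 by (intro power_mono) auto
  also have "\<dots> \<le> (\<Sum>k<n. (norm (u k))\<^sup>2) * (\<Sum>k<n. (norm (y k))\<^sup>2)"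
    by (rule complex_Cauchy_Schwarz_sum)
  finally have "2 * D\<^sup>2 * (2 * s\<^sup>2) \<le> 2 * D\<^sup>2 * ((\<Sum>k<n. (norm (u k))\<^sup>2) * t)"
    unfolding yy by (simp add: power_mult_distrib algebra_simps)
  then have "2 * s\<^sup>2 \<le> (\<Sum>k<n. (norm (u k))\<^sup>2) * t"
    using D by (subst (asm) mult_le_cancel_left_pos) auto
  then show ?thesis by (simp add: s_def t_def e_def)
qed


section \<open>The bound for the logarithmic derivative\<close>

theorem theorem2:
  fixes P :: "complex poly" and z :: complex
  assumes "degree P \<ge> 1"
    and "\<And>w. poly P w = 0 \<Longrightarrow> norm w \<le> 1"
    and "norm z = 1"
    and "poly P z \<noteq> 0"
  shows "Lambda P z \<ge> coeff_bound P \<and>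
    ((\<forall>w. poly P w = 0 \<longrightarrow> norm w = 1) \<longrightarrow> Lambda P z = coeff_bound P)"
proof -
  define n where "n = degree P"
  define R where "R = conj_reciprocal P"
  define c where "c = coeff P"
  have P0: "P \<noteq> 0" using assms(1) by auto
  obtain E where
      ker: "\<And>w v. poly R w * cnj (poly R v) - poly P w * cnj (poly P v)
             = (1 - w * cnj v) * (\<Sum>k<n. poly (E k) w * cnj (poly (E k) v))"
    and circ: "(\<Sum>k<n. (norm (poly (E k) z))\<^sup>2)
             = 2 * Re (z * poly (pderiv P) z * cnj (poly P z)) - n * (norm (poly P z))\<^sup>2"
    and unit: "(\<forall>w. poly P w = 0 \<longrightarrow> norm w = 1) \<Longrightarrow> (\<forall>k<n. E k = 0)"
    using sum_of_squares_kernel_exists[OF assms(2) P0] assms(3) unfolding n_def R_def by blast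
  have R0: "coeff R 0 = cnj (c n)" and R1: "coeff R 1 = cnj (c (n - 1))"
    using assms(1)
    by (simp_all add: R_def conj_reciprocal_def coeff_map_poly coeff_reflect_poly c_def n_def)
  define U where "U = (\<Sum>k<n. (norm (poly (E k) z))\<^sup>2)"
  have U: "U = Lambda P z * (norm (poly P z))\<^sup>2"
  proof -
    have "z * poly (pderiv P) z / poly P z
        = z * poly (pderiv P) z * cnj (poly P z) / of_real ((norm (poly P z))\<^sup>2)"
      using assms(4) unfolding complex_norm_square by simp
    then have "Re (z * poly (pderiv P) z / poly P z)
        = Re (z * poly (pderiv P) z * cnj (poly P z)) / (norm (poly P z))\<^sup>2"
      by (simp only: Re_divide_of_real)
    then have num: "Re (z * poly (pderiv P) z * cnj (poly P z))
        = Re (z * poly (pderiv P) z / poly P z) * (norm (poly P z))\<^sup>2"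
      using assms(4) by (simp only: nonzero_eq_divide_eq norm_eq_zero power_not_zero not_False_eq_True)
    show ?thesis
      unfolding U_def circ num unfolding Lambda_eq[OF assms(3,4)] n_def
      by (simp only: left_diff_distrib mult.assoc)
  qed
  have Ppos: "(norm (poly P z))\<^sup>2 > 0" using assms(4) by simp
  have L0: "Lambda P z \<ge> 0"
    using U Ppos by (metis U_def sum_nonneg zero_le_power2 zero_le_mult_iff not_le)
  let ?p = "\<lambda>k. coeff (E k) 0" and ?q = "\<lambda>k. coeff (E k) 1"
  let ?G0 = "smult (cnj (coeff R 0)) R - smult (cnj (coeff P 0)) P"
  let ?G1 = "pCons 0 ?G0 + smult (cnj (coeff R 1)) R - smult (cnj (coeff P 1)) P"
  have col0: "(\<Sum>k<n. poly (E k) w * cnj (?p k)) = poly ?G0 w" for w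
    using kernel_coefficients(1)[OF ker] by (simp add: mult.commute)
  have col1: "(\<Sum>k<n. poly (E k) w * cnj (?q k)) = poly ?G1 w" for w
    using kernel_coefficients(2)[OF ker] col0 by (simp add: mult.commute)
  have pp: "(\<Sum>k<n. ?p k * cnj (?p k))
      = cnj (c n) * cnj (cnj (c n)) - c 0 * cnj (c 0)"
    using coeff_of_eval_sum[OF col0, of 0] by (simp add: R0 c_def mult.commute)
  have qp: "(\<Sum>k<n. ?q k * cnj (?p k))
      = cnj (c (n - 1)) * cnj (cnj (c n)) - c 1 * cnj (c 0)"
    using coeff_of_eval_sum[OF col0, of 1] R0 R1 by (simp add: c_def mult.commute)
  have qq: "(\<Sum>k<n. ?q k * cnj (?q k)) = (\<Sum>k<n. ?p k * cnj (?p k))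
      + cnj (c (n - 1)) * cnj (cnj (c (n - 1))) - c 1 * cnj (c 1)"
    unfolding pp using coeff_of_eval_sum[OF col1, of 1] R0 R1
    by (simp add: c_def mult.commute)
  have up: "(\<Sum>k<n. poly (E k) z * cnj (?p k))
      = poly R z * cnj (cnj (c n)) - poly P z * cnj (c 0)"
    using col0[of z] by (simp add: R0 c_def mult.commute)
  have uq: "(\<Sum>k<n. poly (E k) z * cnj (?q k))
      = z * (\<Sum>k<n. poly (E k) z * cnj (?p k))
        + poly R z * cnj (cnj (c (n - 1))) - poly P z * cnj (c 1)"
    unfolding col0 using col1[of z] R1 by (simp add: c_def mult.commute)
  have RP: "norm (poly R z) = norm (poly P z)"
  proof -
    have "z * cnj z = 1" using complex_norm_square[of z] assms(3) by simp
    then have "complex_of_real ((norm (poly R z))\<^sup>2) = of_real ((norm (poly P z))\<^sup>2)"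
      using ker[of z z] unfolding complex_norm_square by simp
    then show ?thesis by (simp only: of_real_eq_iff power2_eq_iff_nonneg norm_ge_zero)
  qed
  define D where "D = (norm (c n))\<^sup>2 - (norm (c 0))\<^sup>2"
  have "complex_of_real (\<Sum>k<n. (norm (?p k))\<^sup>2) = of_real D"
    using pp unfolding D_def of_real_sum of_real_diff complex_norm_square
    by (simp add: mult.commute)
  then have Dsum: "D = (\<Sum>k<n. (norm (?p k))\<^sup>2)" by (simp only: of_real_eq_iff)
  have D0: "D \<ge> 0" unfolding Dsum by (simp add: sum_nonneg)
  have D_iff: "D = 0 \<longleftrightarrow> norm (c 0) = norm (c n)"
    unfolding D_def by (auto simp: power2_eq_iff_nonneg)
  have bound: "coeff_bound P = (if D = 0 then 0 else 2 * (norm (c 0) - norm (c n))\<^sup>2 /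
       (D + norm (cnj (c n) * c 1 - c 0 * cnj (c (n - 1)))))"
    unfolding coeff_bound_def Let_def D_iff by (simp add: D_def c_def n_def)
  \<comment> \<open>\<open>D = \<parallel>p\<parallel>\<^sup>2\<close> gives \<open>|c\<^sub>0| \<le> |c\<^sub>n|\<close>, and its vanishing is the exceptional case of the bound.\<close>
  have "Lambda P z \<ge> coeff_bound P"
  proof (cases "D = 0")
    case True
    then show ?thesis using L0 bound by simp
  next
    case False
    then have Dpos: "D > 0" using D0 by simp
    let ?v = "poly R z * cnj (cnj (c n)) - poly P z * cnj (c 0)"
    let ?t = "D + norm (cnj (c n) * c 1 - c 0 * cnj (c (n - 1)))"
    have main: "2 * (norm ?v)\<^sup>2 \<le> U * ?t"
      using gram_lower_bound[OF assms(3) RP _ up uq pp qp qq] Dpos by (simp add: D_def U_def)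
    have "\<bar>norm (c 0) - norm (c n)\<bar> * norm (poly P z) \<le> norm ?v"
    proof -
      have "\<bar>norm (c 0) - norm (c n)\<bar> * norm (poly P z)
          = \<bar>norm (poly P z) * norm (c n) - norm (poly P z) * norm (c 0)\<bar>"
        by (simp add: abs_mult abs_minus_commute flip: right_diff_distrib)
      also have "\<dots> = \<bar>norm (poly R z * cnj (cnj (c n))) - norm (poly P z * cnj (c 0))\<bar>"
        by (simp add: norm_mult RP)
      also have "\<dots> \<le> norm ?v" by (rule norm_triangle_ineq3)
      finally show ?thesis .
    qed
    then have "(\<bar>norm (c 0) - norm (c n)\<bar> * norm (poly P z))\<^sup>2 \<le> (norm ?v)\<^sup>2"
      by (intro power_mono) auto
    then have "2 * (norm (c 0) - norm (c n))\<^sup>2 * (norm (poly P z))\<^sup>2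
        \<le> (Lambda P z * ?t) * (norm (poly P z))\<^sup>2"
      using main by (simp add: U power_mult_distrib mult_ac)
    then have "2 * (norm (c 0) - norm (c n))\<^sup>2 \<le> Lambda P z * ?t"
      using Ppos by (rule mult_right_le_imp_le)
    moreover have "?t > 0" using Dpos by (simp add: add_pos_nonneg)
    ultimately show ?thesis using False bound by (simp add: pos_divide_le_eq)
  qed
  moreover have "Lambda P z = coeff_bound P" if "\<forall>w. poly P w = 0 \<longrightarrow> norm w = 1"
  proof -
    \<comment> \<open>Both sides are zero: the whole family vanishes, hence so do \<open>\<parallel>u\<parallel>\<^sup>2 = U\<close> and \<open>\<parallel>p\<parallel>\<^sup>2 = D\<close>.\<close>
    have "\<forall>k<n. E k = 0" using unit that by blast
    then have "U = 0" "D = 0" by (simp_all add: U_def Dsum)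
    then show ?thesis using U Ppos bound by simp
  qed
  ultimately show ?thesis by blast
qed

end
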